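(* Let $\ell_1,\ell_2,\ell_3$ be positive integers and let $g_2$ be an integer. There exists an integer $g_3$ such that $(0,g_2,g_3)$ is a generalized spline on the edge-labeled triangle $(C_3,L)$ if and only if $g_2$ is a multiple of $\operatorname{lcm}(\ell_1,\gcd(\ell_2,\ell_3))$.
   Context: The edge-labeled triangle $(C_3,L)$ has vertices $v_1,v_2,v_3$, edge $e_1=v_1v_2$ labeled $\ell_1$, edge $e_2=v_2v_3$ labeled $\ell_2$, edge $e_3=v_3v_1$ labeled $\ell_3$. A generalized spline on $(C_3,L)$ is a triple $(g_1,g_2,g_3)\in\mathbb{Z}^3$ with $g_1\equiv g_2\pmod{\ell_1}$, $g_2\equiv g_3\pmod{\ell_2}$, $g_3\equiv g_1\pmod{\ell_3}$. *)

theory Defs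
  imports "HOL-Number_Theory.Cong"
begin

text \<open>
  The labels \<open>(l1, l2, l3)\<close> sit on the edges \<open>v1v2\<close>, \<open>v2v3\<close>, \<open>v3v1\<close> of the
  triangle; the entries \<open>(g1, g2, g3)\<close> sit on the vertices \<open>v1\<close>, \<open>v2\<close>, \<open>v3\<close>.
\<close>

definition triangle_spline :: "int \<times> int \<times> int \<Rightarrow> int \<times> int \<times> int \<Rightarrow> bool" where
  "triangle_spline = (\<lambda>(l1, l2, l3) (g1, g2, g3).
     [g1 = g2] (mod l1) \<and> [g2 = g3] (mod l2) \<and> [g3 = g1] (mod l3))"

end

theory Submission
  imports Defs
begin

text \<open>With first entry 0, the edge \<open>l1\<close> constrains \<open>g2\<close> alone, by
  \<open>l1 dvd g2\<close>. The other two edges ask for a multiple of \<open>l3\<close> congruent to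
  \<open>g2\<close> modulo \<open>l2\<close>; by Bezout (\<open>ex_cong_and_dvd_iff_gcd_dvd\<close>)
  one exists exactly when \<open>gcd l2 l3 dvd g2\<close>. Both divisibilities together say that the
  lcm divides \<open>g2\<close>.\<close>

lemma ex_cong_and_dvd_iff_gcd_dvd:
  fixes a m n :: int
  shows "(\<exists>x. [a = x] (mod m) \<and> n dvd x) \<longleftrightarrow> gcd m n dvd a"
proof
  assume "\<exists>x. [a = x] (mod m) \<and> n dvd x"
  then obtain x where x: "m dvd a - x" "n dvd x"
    by (auto simp: cong_iff_dvd_diff)
  then have "gcd m n dvd (a - x) + x"
    by (intro dvd_add) (auto intro: dvd_trans)
  then show "gcd m n dvd a" by simp
next
  assume "gcd m n dvd a"
  then obtain k where k: "a = gcd m n * k" ..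
  obtain u v where uv: "u * m + v * n = gcd m n"
    using bezout_int by blast
  \<comment> \<open>Bezout scaled by \<open>k\<close> splits \<open>a\<close> into a multiple of
    \<open>m\<close> and a multiple of \<open>n\<close>; the latter is the witness.\<close>
  have "a - v * n * k = m * (u * k)"
    unfolding k uv[symmetric] by (simp add: algebra_simps)
  then have "[a = v * n * k] (mod m)"
    by (simp add: cong_iff_dvd_diff)
  moreover have "n dvd v * n * k" by simp
  ultimately show "\<exists>x. [a = x] (mod m) \<and> n dvd x" by blast
qed

theorem theorem3p1:
  fixes l1 l2 l3 g2 :: int
  assumes "l1 > 0" and "l2 > 0" and "l3 > 0"
  shows "(\<exists>g3::int. triangle_spline (l1, l2, l3) (0, g2, g3)) \<longleftrightarrow> lcm l1 (gcd l2 l3) dvd g2"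
proof -
  have "triangle_spline (l1, l2, l3) (0, g2, g3) \<longleftrightarrow>
      l1 dvd g2 \<and> [g2 = g3] (mod l2) \<and> l3 dvd g3" for g3
    by (simp add: triangle_spline_def cong_0_iff cong_sym_eq[of 0])
  then show ?thesis
    \<comment> \<open>\<open>l1 dvd g2\<close> is free of \<open>g3\<close> and leaves the
      existential, so the lemma applies to the rest.\<close>
    by (simp add: ex_cong_and_dvd_iff_gcd_dvd)
qed

end
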